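(* Let $(L,A)$ be a Lie-Rinehart algebra over $\boldsymbol{k}$, let $V$ be an $A$-module, and let $\nabla$ be an $L$-connection on $V$ with curvature endomorphism $\mathcal{R}$. For $\eta\in\operatorname{Hom}_A(L,\operatorname{End}_A(V))$ let $\mathcal{R}^{\eta}$ denote the curvature endomorphism of the $L$-connection $\nabla^{\eta}:=\nabla+\eta$, and for $g\in\operatorname{Aut}_A(V)$ put $$g.\eta:=\rho_g+g\eta g^{-1},\qquad \rho_g:=g\nabla(g^{-1})\in\operatorname{Hom}_A(L,\operatorname{End}_A(V)).$$ Then for each $\eta\in\operatorname{Hom}_A(L,\operatorname{End}_A(V))$ and each $g\in\operatorname{Aut}_A(V)$ the curvature endomorphism of $\nabla^{g.\eta}=\nabla+g.\eta$ is $$\mathcal{R}^{g.\eta}=g\,\mathcal{R}^{\eta}g^{-1}.$$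
   Context: $\boldsymbol{k}$ is a field of characteristic zero. A Lie-Rinehart algebra $(L,A)$ consists of a commutative unital $\boldsymbol{k}$-algebra $A$ and an $A$-module $L$ with a $\boldsymbol{k}$-bilinear Lie bracket such that $L$ acts on $A$ by $\boldsymbol{k}$-linear derivations $a\mapsto X(a)$, with $(aX)(b)=a(X(b))$ and $[X,aY]=X(a)Y+a[X,Y]$. An $L$-connection on an $A$-module $V$ is an $A$-linear assignment $L\ni X\mapsto\nabla_X\in\operatorname{End}_{\boldsymbol{k}}(V)$ with $\nabla_X(av)=X(a)v+a\nabla_Xv$. It induces an $L$-connection on $\operatorname{End}_A(V)$, also denoted $\nabla$, by $(\nabla_X\varphi)(v)=\nabla_X(\varphi(v))-\varphi(\nabla_Xv)$. The curvature endomorphism is the $\operatorname{End}_A(V)$-valued alternating $A$-bilinear form $\mathcal{R}(X,Y)=[\nabla_X,\nabla_Y]-\nabla_{[X,Y]}$. The notation means: $\rho_g(X)=g\circ\nabla_X(g^{-1})$, $(g\eta g^{-1})(X)=g\,\eta(X)\,g^{-1}$, $(\nabla+\eta)_X=\nabla_X+\eta(X)$, and $(g\mathcal{R}^\eta g^{-1})(X,Y)=g\,\mathcal{R}^\eta(X,Y)\,g^{-1}$. *)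

theory Defs
  imports "HOL-Algebra.Module"
begin

definition module_hom ::
  "('r, 'x) ring_scheme \<Rightarrow> ('r, 'm, 'y) module_scheme \<Rightarrow> ('r, 'n, 'z) module_scheme \<Rightarrow> ('m \<Rightarrow> 'n) set"
  where "module_hom R M N =
    {f \<in> carrier M \<rightarrow> carrier N.
      (\<forall>x \<in> carrier M. \<forall>y \<in> carrier M. f (x \<oplus>\<^bsub>M\<^esub> y) = f x \<oplus>\<^bsub>N\<^esub> f y) \<and>
      (\<forall>a \<in> carrier R. \<forall>x \<in> carrier M. f (a \<odot>\<^bsub>M\<^esub> x) = a \<odot>\<^bsub>N\<^esub> f x)}"

text \<open>For a unital algebra \<open>A\<close> over \<open>K\<close>, an \<open>A\<close>-module \<open>M\<close> is viewed as a \<open>K\<close>-module along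
  the structure map sending \<open>c\<close> to \<open>c \<odot> \<one>\<close>.\<close>

definition restrict_scalars ::
  "('k, 'a, 'x) module_scheme \<Rightarrow> ('a, 'm, 'y) module_scheme \<Rightarrow> ('k, 'm) module"
  where "restrict_scalars A M =
    \<lparr>carrier = carrier M, mult = mult M, one = one M, zero = zero M, add = add M,
     smult = (\<lambda>c x. (c \<odot>\<^bsub>A\<^esub> \<one>\<^bsub>A\<^esub>) \<odot>\<^bsub>M\<^esub> x)\<rparr>"

text \<open>Endomorphisms are represented as extensional functions (with value \<open>undefined\<close> outside the
  carrier), so that equality of endomorphisms is equality in HOL. The set \<open>E\<close> of admissible maps
  is a separate parameter because \<open>K\<close>-linear endomorphisms of an \<open>A\<close>-module will carry the
  pointwise \<open>A\<close>-module structure.\<close>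

definition endo_structure ::
  "('m \<Rightarrow> 'm) set \<Rightarrow> ('r, 'm, 'x) module_scheme \<Rightarrow> ('r, 'm \<Rightarrow> 'm) module"
  where "endo_structure E M =
    \<lparr>carrier = E,
     mult = compose (carrier M),
     one = (\<lambda>v \<in> carrier M. v),
     zero = (\<lambda>v \<in> carrier M. \<zero>\<^bsub>M\<^esub>),
     add = (\<lambda>\<phi> \<psi>. \<lambda>v \<in> carrier M. \<phi> v \<oplus>\<^bsub>M\<^esub> \<psi> v),
     smult = (\<lambda>a \<phi>. \<lambda>v \<in> carrier M. a \<odot>\<^bsub>M\<^esub> \<phi> v)\<rparr>"

definition End_mod ::
  "('a, 'x) ring_scheme \<Rightarrow> ('a, 'v, 'y) module_scheme \<Rightarrow> ('a, 'v \<Rightarrow> 'v) module"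
  where "End_mod A V = endo_structure (module_hom A V V \<inter> extensional (carrier V)) V"

abbreviation Aut_mod ::
  "('a, 'x) ring_scheme \<Rightarrow> ('a, 'v, 'y) module_scheme \<Rightarrow> ('v \<Rightarrow> 'v) set"
  where "Aut_mod A V \<equiv> Units (End_mod A V)"

text \<open>\<open>End\<^sub>K(V)\<close> for an \<open>A\<close>-module \<open>V\<close>, with \<open>(a\<phi>)(v) = a \<phi>(v)\<close> for \<open>a\<close> in \<open>A\<close>.\<close>

definition End_base ::
  "('k, 'x) ring_scheme \<Rightarrow> ('k, 'a, 'y) module_scheme \<Rightarrow> ('a, 'v, 'z) module_scheme
    \<Rightarrow> ('a, 'v \<Rightarrow> 'v) module"
  where "End_base K A V =
    endo_structure
      (module_hom K (restrict_scalars A V) (restrict_scalars A V) \<inter> extensional (carrier V)) V"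

text \<open>The Lie bracket of \<open>L\<close> is \<open>br\<close>, and \<open>act X a\<close> is \<open>X(a)\<close>. The multiplication and unit
  fields of the record \<open>L\<close> play no role.\<close>

locale lie_rinehart =
  fixes K :: "('k, 'x) ring_scheme"
    and A :: "('k, 'a, 'y) module_scheme"
    and L :: "('a, 'l, 'z) module_scheme"
    and br :: "'l \<Rightarrow> 'l \<Rightarrow> 'l"
    and act :: "'l \<Rightarrow> 'a \<Rightarrow> 'a"
  assumes field_K: "field K"
    and char_zero_K: "\<And>n::nat. n > 0 \<Longrightarrow> [n] \<cdot>\<^bsub>K\<^esub> \<one>\<^bsub>K\<^esub> \<noteq> \<zero>\<^bsub>K\<^esub>"
    and algebra_A: "algebra K A"
    and module_L: "module A L"
    and br_linear_right:
      "\<And>X. X \<in> carrier L \<Longrightarrow>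
        (\<lambda>Y. br X Y) \<in> module_hom K (restrict_scalars A L) (restrict_scalars A L)"
    and br_linear_left:
      "\<And>Y. Y \<in> carrier L \<Longrightarrow>
        (\<lambda>X. br X Y) \<in> module_hom K (restrict_scalars A L) (restrict_scalars A L)"
    and br_alternating: "\<And>X. X \<in> carrier L \<Longrightarrow> br X X = \<zero>\<^bsub>L\<^esub>"
    and br_jacobi:
      "\<And>X Y Z. \<lbrakk>X \<in> carrier L; Y \<in> carrier L; Z \<in> carrier L\<rbrakk> \<Longrightarrow>
        br X (br Y Z) \<oplus>\<^bsub>L\<^esub> br Y (br Z X) \<oplus>\<^bsub>L\<^esub> br Z (br X Y) = \<zero>\<^bsub>L\<^esub>"
    and act_linear: "\<And>X. X \<in> carrier L \<Longrightarrow> act X \<in> module_hom K A A"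
    and act_leibniz:
      "\<And>X a b. \<lbrakk>X \<in> carrier L; a \<in> carrier A; b \<in> carrier A\<rbrakk> \<Longrightarrow>
        act X (a \<otimes>\<^bsub>A\<^esub> b) = act X a \<otimes>\<^bsub>A\<^esub> b \<oplus>\<^bsub>A\<^esub> a \<otimes>\<^bsub>A\<^esub> act X b"
    and act_add:
      "\<And>X Y a. \<lbrakk>X \<in> carrier L; Y \<in> carrier L; a \<in> carrier A\<rbrakk> \<Longrightarrow>
        act (X \<oplus>\<^bsub>L\<^esub> Y) a = act X a \<oplus>\<^bsub>A\<^esub> act Y a"
    and act_smult:
      "\<And>a X b. \<lbrakk>a \<in> carrier A; X \<in> carrier L; b \<in> carrier A\<rbrakk> \<Longrightarrow>
        act (a \<odot>\<^bsub>L\<^esub> X) b = a \<otimes>\<^bsub>A\<^esub> act X b"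
    and act_br:
      "\<And>X Y a. \<lbrakk>X \<in> carrier L; Y \<in> carrier L; a \<in> carrier A\<rbrakk> \<Longrightarrow>
        act (br X Y) a = act X (act Y a) \<ominus>\<^bsub>A\<^esub> act Y (act X a)"
    and br_smult:
      "\<And>X a Y. \<lbrakk>X \<in> carrier L; a \<in> carrier A; Y \<in> carrier L\<rbrakk> \<Longrightarrow>
        br X (a \<odot>\<^bsub>L\<^esub> Y) = act X a \<odot>\<^bsub>L\<^esub> Y \<oplus>\<^bsub>L\<^esub> a \<odot>\<^bsub>L\<^esub> br X Y"

definition L_connection ::
  "('k, 'x) ring_scheme \<Rightarrow> ('k, 'a, 'y) module_scheme \<Rightarrow> ('a, 'l, 'z) module_scheme
    \<Rightarrow> ('l \<Rightarrow> 'a \<Rightarrow> 'a) \<Rightarrow> ('a, 'v, 'w) module_scheme \<Rightarrow> ('l \<Rightarrow> 'v \<Rightarrow> 'v) \<Rightarrow> bool"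
  where "L_connection K A L act V nabla \<longleftrightarrow>
    nabla \<in> module_hom A L (End_base K A V) \<and>
    (\<forall>X \<in> carrier L. \<forall>a \<in> carrier A. \<forall>v \<in> carrier V.
      nabla X (a \<odot>\<^bsub>V\<^esub> v) = act X a \<odot>\<^bsub>V\<^esub> v \<oplus>\<^bsub>V\<^esub> a \<odot>\<^bsub>V\<^esub> nabla X v)"

definition curvature ::
  "('k, 'x) ring_scheme \<Rightarrow> ('k, 'a, 'y) module_scheme \<Rightarrow> ('l \<Rightarrow> 'l \<Rightarrow> 'l)
    \<Rightarrow> ('a, 'v, 'w) module_scheme \<Rightarrow> ('l \<Rightarrow> 'v \<Rightarrow> 'v) \<Rightarrow> 'l \<Rightarrow> 'l \<Rightarrow> 'v \<Rightarrow> 'v"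
  where "curvature K A br V nabla X Y =
    (nabla X \<otimes>\<^bsub>End_base K A V\<^esub> nabla Y \<ominus>\<^bsub>End_base K A V\<^esub> nabla Y \<otimes>\<^bsub>End_base K A V\<^esub> nabla X)
      \<ominus>\<^bsub>End_base K A V\<^esub> nabla (br X Y)"

definition End_connection ::
  "('a, 'v, 'w) module_scheme \<Rightarrow> ('l \<Rightarrow> 'v \<Rightarrow> 'v) \<Rightarrow> 'l \<Rightarrow> ('v \<Rightarrow> 'v) \<Rightarrow> 'v \<Rightarrow> 'v"
  where "End_connection V nabla X \<phi> = (\<lambda>v \<in> carrier V. nabla X (\<phi> v) \<ominus>\<^bsub>V\<^esub> \<phi> (nabla X v))"

definition add_form ::
  "('k, 'x) ring_scheme \<Rightarrow> ('k, 'a, 'y) module_scheme \<Rightarrow> ('a, 'v, 'w) module_scheme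
    \<Rightarrow> ('l \<Rightarrow> 'v \<Rightarrow> 'v) \<Rightarrow> ('l \<Rightarrow> 'v \<Rightarrow> 'v) \<Rightarrow> 'l \<Rightarrow> 'v \<Rightarrow> 'v"
  where "add_form K A V nabla \<eta> X = nabla X \<oplus>\<^bsub>End_base K A V\<^esub> \<eta> X"

definition gauge_rho ::
  "('a, 'x) ring_scheme \<Rightarrow> ('a, 'v, 'w) module_scheme
    \<Rightarrow> ('l \<Rightarrow> 'v \<Rightarrow> 'v) \<Rightarrow> ('v \<Rightarrow> 'v) \<Rightarrow> 'l \<Rightarrow> 'v \<Rightarrow> 'v"
  where "gauge_rho A V nabla g X =
    g \<otimes>\<^bsub>End_mod A V\<^esub> End_connection V nabla X (inv\<^bsub>End_mod A V\<^esub> g)"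

definition Aut_conj ::
  "('a, 'x) ring_scheme \<Rightarrow> ('a, 'v, 'w) module_scheme \<Rightarrow> ('v \<Rightarrow> 'v) \<Rightarrow> ('v \<Rightarrow> 'v) \<Rightarrow> 'v \<Rightarrow> 'v"
  where "Aut_conj A V g \<phi> = g \<otimes>\<^bsub>End_mod A V\<^esub> \<phi> \<otimes>\<^bsub>End_mod A V\<^esub> inv\<^bsub>End_mod A V\<^esub> g"

definition gauge_action ::
  "('a, 'x) ring_scheme \<Rightarrow> ('a, 'v, 'w) module_scheme
    \<Rightarrow> ('l \<Rightarrow> 'v \<Rightarrow> 'v) \<Rightarrow> ('v \<Rightarrow> 'v) \<Rightarrow> ('l \<Rightarrow> 'v \<Rightarrow> 'v) \<Rightarrow> 'l \<Rightarrow> 'v \<Rightarrow> 'v"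
  where "gauge_action A V nabla g \<eta> X =
    gauge_rho A V nabla g X \<oplus>\<^bsub>End_mod A V\<^esub> Aut_conj A V g (\<eta> X)"

end

theory Submission
  imports Defs
begin

text \<open>
  A gauge transformation acts on connections by conjugation, and the formula
  \<open>g.\<eta> = g \<nabla>(g\<^sup>-\<^sup>1) + g \<eta> g\<^sup>-\<^sup>1\<close> is this action seen from the base point \<open>\<nabla>\<close>. Indeed, in
  \<open>End\<^sub>K(V)\<close> the induced connection on endomorphisms is a commutator with \<open>\<nabla>\<^sub>X\<close>, so
  \<open>\<rho>\<^sub>g(X) = g (\<nabla>\<^sub>X g\<^sup>-\<^sup>1 - g\<^sup>-\<^sup>1 \<nabla>\<^sub>X) = g \<nabla>\<^sub>X g\<^sup>-\<^sup>1 - \<nabla>\<^sub>X\<close> (\<open>mult_End_connection\<close>), and hence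
  \<open>(g.\<eta>)(X) = g (\<nabla> + \<eta>)\<^sub>X g\<^sup>-\<^sup>1 - \<nabla>\<^sub>X\<close> (\<open>gauge_shift\<close>). In other words
  \<open>\<nabla> + g.\<eta> = g (\<nabla> + \<eta>) g\<^sup>-\<^sup>1\<close>.

  The curvature is a polynomial expression in the values of the connection, computed in the ring
  \<open>End\<^sub>K(V)\<close>, and conjugation by \<open>g\<close> is an automorphism of that ring. So conjugating the
  connection conjugates the curvature (\<open>curvature_conj\<close>).

  The same point of view shows that \<open>\<rho>\<^sub>g\<close> and \<open>g.\<eta>\<close> are \<open>A\<close>-linear forms with values in
  \<open>End\<^sub>A(V)\<close>. Connections form an affine space over \<open>Hom\<^sub>A(L, End\<^sub>A(V))\<close>
  (\<open>connection_add_form\<close>, \<open>connection_diff\<close>), conjugation preserves connections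
  (\<open>connection_conj\<close>), and \<open>\<rho>\<^sub>g\<close> and \<open>g.\<eta>\<close> are differences of connections.

  All computations thus take place in \<open>End\<^sub>K(V)\<close>, which is a ring and an \<open>A\<close>-module and contains
  \<open>End\<^sub>A(V)\<close> with the same operations.
\<close>

section \<open>Endomorphism rings\<close>

lemma End_modI:
  assumes "\<And>v. v \<in> carrier M \<Longrightarrow> f v \<in> carrier M"
    and "\<And>v w. \<lbrakk>v \<in> carrier M; w \<in> carrier M\<rbrakk> \<Longrightarrow> f (v \<oplus>\<^bsub>M\<^esub> w) = f v \<oplus>\<^bsub>M\<^esub> f w"
    and "\<And>a v. \<lbrakk>a \<in> carrier R; v \<in> carrier M\<rbrakk> \<Longrightarrow> f (a \<odot>\<^bsub>M\<^esub> v) = a \<odot>\<^bsub>M\<^esub> f v"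
    and "f \<in> extensional (carrier M)"
  shows "f \<in> carrier (End_mod R M)"
  using assms by (auto simp: End_mod_def endo_structure_def module_hom_def)

lemma End_modD:
  assumes "f \<in> carrier (End_mod R M)"
  shows "v \<in> carrier M \<Longrightarrow> f v \<in> carrier M"
    and "\<lbrakk>v \<in> carrier M; w \<in> carrier M\<rbrakk> \<Longrightarrow> f (v \<oplus>\<^bsub>M\<^esub> w) = f v \<oplus>\<^bsub>M\<^esub> f w"
    and "\<lbrakk>a \<in> carrier R; v \<in> carrier M\<rbrakk> \<Longrightarrow> f (a \<odot>\<^bsub>M\<^esub> v) = a \<odot>\<^bsub>M\<^esub> f v"
    and "f \<in> extensional (carrier M)"
  using assms by (auto simp: End_mod_def endo_structure_def module_hom_def)

lemma End_mod_ops: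
  "f \<otimes>\<^bsub>End_mod R M\<^esub> h = compose (carrier M) f h"
  "f \<oplus>\<^bsub>End_mod R M\<^esub> h = (\<lambda>v \<in> carrier M. f v \<oplus>\<^bsub>M\<^esub> h v)"
  "\<one>\<^bsub>End_mod R M\<^esub> = (\<lambda>v \<in> carrier M. v)"
  "\<zero>\<^bsub>End_mod R M\<^esub> = (\<lambda>v \<in> carrier M. \<zero>\<^bsub>M\<^esub>)"
  by (simp_all add: End_mod_def endo_structure_def)

lemma ring_End_mod:
  assumes "module R M"
  shows "ring (End_mod R M)"
proof -
  interpret module R M by fact
  note D = End_modD[where R=R and M=M]
  have ab: "abelian_group (End_mod R M)"
  proof (rule abelian_groupI)
    fix f h k
    assume f: "f \<in> carrier (End_mod R M)"
    then show "\<zero>\<^bsub>End_mod R M\<^esub> \<oplus>\<^bsub>End_mod R M\<^esub> f = f"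
      by (intro extensionalityI[of _ "carrier M"]) (auto simp: End_mod_ops D)
    have "(\<lambda>v \<in> carrier M. \<ominus>\<^bsub>M\<^esub> f v) \<in> carrier (End_mod R M)"
      by (rule End_modI) (auto simp: D[OF f] smult_r_minus M.minus_add)
    moreover have "(\<lambda>v \<in> carrier M. \<ominus>\<^bsub>M\<^esub> f v) \<oplus>\<^bsub>End_mod R M\<^esub> f = \<zero>\<^bsub>End_mod R M\<^esub>"
      by (auto simp: End_mod_ops D[OF f] M.l_neg)
    ultimately show "\<exists>y \<in> carrier (End_mod R M). y \<oplus>\<^bsub>End_mod R M\<^esub> f = \<zero>\<^bsub>End_mod R M\<^esub>"
      by blast
    assume h: "h \<in> carrier (End_mod R M)"
    show "f \<oplus>\<^bsub>End_mod R M\<^esub> h \<in> carrier (End_mod R M)"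
      by (rule End_modI)
        (auto simp: End_mod_ops D[OF f] D[OF h] M.a_ac smult_r_distr)
    show "f \<oplus>\<^bsub>End_mod R M\<^esub> h = h \<oplus>\<^bsub>End_mod R M\<^esub> f"
      by (auto simp: End_mod_ops D[OF f] D[OF h] M.a_ac)
    assume k: "k \<in> carrier (End_mod R M)"
    show "f \<oplus>\<^bsub>End_mod R M\<^esub> h \<oplus>\<^bsub>End_mod R M\<^esub> k = f \<oplus>\<^bsub>End_mod R M\<^esub> (h \<oplus>\<^bsub>End_mod R M\<^esub> k)"
      by (auto simp: End_mod_ops D[OF f] D[OF h] D[OF k] M.a_ac)
  next
    show "\<zero>\<^bsub>End_mod R M\<^esub> \<in> carrier (End_mod R M)"
      by (rule End_modI) (auto simp: End_mod_ops)
  qed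
  have mon: "monoid (End_mod R M)"
  proof (rule monoidI)
    fix f h k
    assume f: "f \<in> carrier (End_mod R M)"
    show "\<one>\<^bsub>End_mod R M\<^esub> \<otimes>\<^bsub>End_mod R M\<^esub> f = f" "f \<otimes>\<^bsub>End_mod R M\<^esub> \<one>\<^bsub>End_mod R M\<^esub> = f"
      by (auto intro!: extensionalityI[of _ "carrier M"] simp: End_mod_ops D[OF f] compose_def)
    assume h: "h \<in> carrier (End_mod R M)"
    show "f \<otimes>\<^bsub>End_mod R M\<^esub> h \<in> carrier (End_mod R M)"
      by (rule End_modI) (auto simp: End_mod_ops compose_def D[OF f] D[OF h])
    assume k: "k \<in> carrier (End_mod R M)"
    show "f \<otimes>\<^bsub>End_mod R M\<^esub> h \<otimes>\<^bsub>End_mod R M\<^esub> k = f \<otimes>\<^bsub>End_mod R M\<^esub> (h \<otimes>\<^bsub>End_mod R M\<^esub> k)"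
      by (auto simp: End_mod_ops compose_def D[OF k])
  next
    show "\<one>\<^bsub>End_mod R M\<^esub> \<in> carrier (End_mod R M)"
      by (rule End_modI) (auto simp: End_mod_ops)
  qed
  show ?thesis
    by (rule ringI[OF ab mon]) (auto simp: End_mod_ops compose_def D)
qed

lemma abelian_group_cong:
  assumes "abelian_group R"
    and "carrier S = carrier R" "zero S = zero R" "add S = add R"
  shows "abelian_group S"
proof -
  interpret R: abelian_group R by fact
  show ?thesis
    by (rule abelian_groupI)
      (auto simp: assms R.a_ac intro: bexI[of _ "\<ominus>\<^bsub>R\<^esub> x" for x] R.l_neg)
qed

text \<open>The endomorphism structures of \<open>V\<close> over \<open>K\<close> and over \<open>A\<close> carry scalar multiplications of
  different types. The ring axioms do not see scalars, so they transfer along the remaining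
  fields.\<close>

lemma ring_cong:
  assumes "ring R"
    and "carrier S = carrier R" "mult S = mult R" "one S = one R"
      "zero S = zero R" "add S = add R"
  shows "ring S"
proof -
  interpret R: ring R by fact
  show ?thesis
  proof (rule ringI)
    show "abelian_group S"
      by (rule abelian_group_cong[OF R.abelian_group_axioms]) (simp_all add: assms)
    show "monoid S"
      by (rule monoidI) (simp_all add: assms R.m_assoc)
  qed (simp_all add: assms R.l_distr R.r_distr)
qed

text \<open>Together with \<open>conj_minus\<close> below, this says that conjugation respects the operations from
  which the curvature is built.\<close>

lemma (in ring) conj_mult:
  assumes "g \<in> carrier R" "h \<in> carrier R" "h \<otimes> g = \<one>" "x \<in> carrier R" "y \<in> carrier R"
  shows "(g \<otimes> x \<otimes> h) \<otimes> (g \<otimes> y \<otimes> h) = g \<otimes> (x \<otimes> y) \<otimes> h"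
proof -
  have "(g \<otimes> x \<otimes> h) \<otimes> (g \<otimes> y \<otimes> h) = g \<otimes> x \<otimes> (h \<otimes> g) \<otimes> y \<otimes> h"
    using assms(1,2,4,5) by (simp add: m_assoc)
  then show ?thesis
    using assms by (simp add: m_assoc)
qed

lemma (in ring) conj_minus:
  assumes "g \<in> carrier R" "h \<in> carrier R" "x \<in> carrier R" "y \<in> carrier R"
  shows "(g \<otimes> x \<otimes> h) \<ominus> (g \<otimes> y \<otimes> h) = g \<otimes> (x \<ominus> y) \<otimes> h"
  using assms by (simp add: a_minus_def r_distr l_distr r_minus l_minus)

section \<open>Connections on a module\<close>

locale lie_rinehart_module = lie_rinehart K A L br act + V: module A V
  for K :: "('k, 'x) ring_scheme"
    and A :: "('k, 'a, 'y) module_scheme"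
    and L :: "('a, 'l, 'z) module_scheme"
    and br :: "'l \<Rightarrow> 'l \<Rightarrow> 'l"
    and act :: "'l \<Rightarrow> 'a \<Rightarrow> 'a"
    and V :: "('a, 'v, 'w) module_scheme"
begin

sublocale KA: algebra K A by (rule algebra_A)
sublocale L: module A L by (rule module_L)

abbreviation E where "E \<equiv> End_base K A V"
abbreviation EA where "EA \<equiv> End_mod A V"
abbreviation conn where "conn \<equiv> L_connection K A L act V"

lemma scalar_closed: "c \<in> carrier K \<Longrightarrow> c \<odot>\<^bsub>A\<^esub> \<one>\<^bsub>A\<^esub> \<in> carrier A"
  by (simp add: KA.smult_closed)

lemma module_restrict_scalars: "module K (restrict_scalars A V)"
proof (rule moduleI)
  show "cring K" by (rule KA.R.is_cring)
  show "abelian_group (restrict_scalars A V)"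
    by (rule abelian_group_cong[OF V.M.abelian_group_axioms]) (simp_all add: restrict_scalars_def)
next
  fix a b x
  assume *: "a \<in> carrier K" "b \<in> carrier K" "x \<in> carrier (restrict_scalars A V)"
  have "(a \<otimes>\<^bsub>K\<^esub> b) \<odot>\<^bsub>A\<^esub> \<one>\<^bsub>A\<^esub> = (a \<odot>\<^bsub>A\<^esub> \<one>\<^bsub>A\<^esub>) \<otimes>\<^bsub>A\<^esub> (b \<odot>\<^bsub>A\<^esub> \<one>\<^bsub>A\<^esub>)"
    using * by (simp add: KA.smult_assoc1 KA.smult_assoc2 scalar_closed)
  then show "(a \<otimes>\<^bsub>K\<^esub> b) \<odot>\<^bsub>restrict_scalars A V\<^esub> x
      = a \<odot>\<^bsub>restrict_scalars A V\<^esub> (b \<odot>\<^bsub>restrict_scalars A V\<^esub> x)"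
    using * by (simp add: restrict_scalars_def V.smult_assoc1 scalar_closed)
qed (auto simp: restrict_scalars_def scalar_closed KA.smult_l_distr V.smult_l_distr
    V.smult_r_distr KA.smult_one V.smult_one)

sublocale E: ring E
  by (rule ring_cong[OF ring_End_mod[OF module_restrict_scalars]])
    (simp_all add: End_base_def End_mod_def endo_structure_def restrict_scalars_def)
sublocale EA: ring EA
  by (rule ring_End_mod) (rule V.module_axioms)

lemma E_ops:
  "f \<otimes>\<^bsub>E\<^esub> h = compose (carrier V) f h"
  "f \<oplus>\<^bsub>E\<^esub> h = (\<lambda>v \<in> carrier V. f v \<oplus>\<^bsub>V\<^esub> h v)"
  "a \<odot>\<^bsub>E\<^esub> f = (\<lambda>v \<in> carrier V. a \<odot>\<^bsub>V\<^esub> f v)"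
  "\<one>\<^bsub>E\<^esub> = (\<lambda>v \<in> carrier V. v)"
  "\<zero>\<^bsub>E\<^esub> = (\<lambda>v \<in> carrier V. \<zero>\<^bsub>V\<^esub>)"
  by (simp_all add: End_base_def endo_structure_def)

text \<open>\<open>End\<^sub>A(V)\<close> is a subring of \<open>End\<^sub>K(V)\<close> on the nose: the operations are the same functions.
  This moves every expression of the gauge action into \<open>End\<^sub>K(V)\<close>, where \<open>\<nabla>\<^sub>X\<close> lives.\<close>

lemma EA_eq_E:
  "(\<otimes>\<^bsub>EA\<^esub>) = (\<otimes>\<^bsub>E\<^esub>)" "(\<oplus>\<^bsub>EA\<^esub>) = (\<oplus>\<^bsub>E\<^esub>)" "(\<odot>\<^bsub>EA\<^esub>) = (\<odot>\<^bsub>E\<^esub>)"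
  "\<one>\<^bsub>EA\<^esub> = \<one>\<^bsub>E\<^esub>"
  by (simp_all add: End_base_def End_mod_def endo_structure_def)

lemma E_I:
  assumes "\<And>v. v \<in> carrier V \<Longrightarrow> f v \<in> carrier V"
    and "\<And>v w. \<lbrakk>v \<in> carrier V; w \<in> carrier V\<rbrakk> \<Longrightarrow> f (v \<oplus>\<^bsub>V\<^esub> w) = f v \<oplus>\<^bsub>V\<^esub> f w"
    and "\<And>c v. \<lbrakk>c \<in> carrier K; v \<in> carrier V\<rbrakk>
      \<Longrightarrow> f ((c \<odot>\<^bsub>A\<^esub> \<one>\<^bsub>A\<^esub>) \<odot>\<^bsub>V\<^esub> v) = (c \<odot>\<^bsub>A\<^esub> \<one>\<^bsub>A\<^esub>) \<odot>\<^bsub>V\<^esub> f v"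
    and "f \<in> extensional (carrier V)"
  shows "f \<in> carrier E"
  using assms
  by (auto simp: End_base_def endo_structure_def module_hom_def restrict_scalars_def)

lemma E_D:
  assumes "f \<in> carrier E"
  shows "v \<in> carrier V \<Longrightarrow> f v \<in> carrier V"
    and "\<lbrakk>v \<in> carrier V; w \<in> carrier V\<rbrakk> \<Longrightarrow> f (v \<oplus>\<^bsub>V\<^esub> w) = f v \<oplus>\<^bsub>V\<^esub> f w"
    and "\<lbrakk>c \<in> carrier K; v \<in> carrier V\<rbrakk>
      \<Longrightarrow> f ((c \<odot>\<^bsub>A\<^esub> \<one>\<^bsub>A\<^esub>) \<odot>\<^bsub>V\<^esub> v) = (c \<odot>\<^bsub>A\<^esub> \<one>\<^bsub>A\<^esub>) \<odot>\<^bsub>V\<^esub> f v"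
    and "f \<in> extensional (carrier V)"
  using assms
  by (auto simp: End_base_def endo_structure_def module_hom_def restrict_scalars_def)

lemma EA_subset_E: "f \<in> carrier EA \<Longrightarrow> f \<in> carrier E"
  by (rule E_I) (simp_all add: End_modD scalar_closed)

text \<open>The additive inverse in \<open>End\<^sub>K(V)\<close> is only characterised implicitly by the group structure, so
  the pointwise formula is recovered by cancellation.\<close>

lemma E_minus_apply:
  assumes "f \<in> carrier E" "h \<in> carrier E" "v \<in> carrier V"
  shows "(f \<ominus>\<^bsub>E\<^esub> h) v = f v \<ominus>\<^bsub>V\<^esub> h v"
proof -
  have "(f \<ominus>\<^bsub>E\<^esub> h) \<oplus>\<^bsub>E\<^esub> h = f"
    using assms by (simp add: a_minus_def E.a_assoc E.l_neg)
  from fun_cong[OF this, of v]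
  have "f v \<ominus>\<^bsub>V\<^esub> h v = ((f \<ominus>\<^bsub>E\<^esub> h) v \<oplus>\<^bsub>V\<^esub> h v) \<ominus>\<^bsub>V\<^esub> h v"
    using assms(3) by (simp add: E_ops)
  then show ?thesis
    using E_D(1)[OF E.minus_closed[OF assms(1,2)] assms(3)] E_D(1)[OF assms(2,3)]
    by (simp add: a_minus_def V.M.a_assoc V.M.r_neg)
qed

text \<open>Because \<open>A\<close> is commutative, multiplication by \<open>a\<close> commutes with the scalars \<open>c \<odot> \<one>\<close> coming
  from \<open>K\<close>.\<close>

lemma smult_in_E:
  assumes a: "a \<in> carrier A" and f: "f \<in> carrier E"
  shows "a \<odot>\<^bsub>E\<^esub> f \<in> carrier E"
proof (rule E_I)
  fix c v assume c: "c \<in> carrier K" and v: "v \<in> carrier V"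
  let ?c = "c \<odot>\<^bsub>A\<^esub> \<one>\<^bsub>A\<^esub>"
  have "a \<odot>\<^bsub>V\<^esub> (?c \<odot>\<^bsub>V\<^esub> f v) = (a \<otimes>\<^bsub>A\<^esub> ?c) \<odot>\<^bsub>V\<^esub> f v"
    using a c v by (simp add: V.smult_assoc1 scalar_closed E_D[OF f])
  also have "\<dots> = (?c \<otimes>\<^bsub>A\<^esub> a) \<odot>\<^bsub>V\<^esub> f v"
    using a c by (simp add: V.R.m_comm scalar_closed)
  also have "\<dots> = ?c \<odot>\<^bsub>V\<^esub> (a \<odot>\<^bsub>V\<^esub> f v)"
    using a c v by (simp only: V.smult_assoc1 scalar_closed E_D[OF f])
  finally show "(a \<odot>\<^bsub>E\<^esub> f) (?c \<odot>\<^bsub>V\<^esub> v) = ?c \<odot>\<^bsub>V\<^esub> (a \<odot>\<^bsub>E\<^esub> f) v"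
    using c v by (simp add: E_ops scalar_closed E_D[OF f])
qed (use a in \<open>auto simp: E_ops E_D[OF f] V.smult_r_distr\<close>)

sublocale EM: module A E
proof (rule moduleI)
  show "cring A" by (rule V.R.is_cring)
  show "abelian_group E" by (rule E.abelian_group_axioms)
next
  fix f assume f: "f \<in> carrier E"
  show "\<one>\<^bsub>A\<^esub> \<odot>\<^bsub>E\<^esub> f = f"
    by (rule extensionalityI[of _ "carrier V"]) (auto simp: E_ops E_D[OF f] V.smult_one)
qed (auto simp: smult_in_E[unfolded E_ops] E_ops E_D V.smult_l_distr V.smult_r_distr V.smult_assoc1)

lemma module_homI:
  assumes "\<And>X. X \<in> carrier L \<Longrightarrow> f X \<in> carrier N"
    and "\<And>X Y. \<lbrakk>X \<in> carrier L; Y \<in> carrier L\<rbrakk> \<Longrightarrow> f (X \<oplus>\<^bsub>L\<^esub> Y) = f X \<oplus>\<^bsub>N\<^esub> f Y"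
    and "\<And>a X. \<lbrakk>a \<in> carrier A; X \<in> carrier L\<rbrakk> \<Longrightarrow> f (a \<odot>\<^bsub>L\<^esub> X) = a \<odot>\<^bsub>N\<^esub> f X"
  shows "f \<in> module_hom A L N"
  using assms by (auto simp: module_hom_def)

lemma module_homD:
  assumes "f \<in> module_hom A L N"
  shows "X \<in> carrier L \<Longrightarrow> f X \<in> carrier N"
    and "\<lbrakk>X \<in> carrier L; Y \<in> carrier L\<rbrakk> \<Longrightarrow> f (X \<oplus>\<^bsub>L\<^esub> Y) = f X \<oplus>\<^bsub>N\<^esub> f Y"
    and "\<lbrakk>a \<in> carrier A; X \<in> carrier L\<rbrakk> \<Longrightarrow> f (a \<odot>\<^bsub>L\<^esub> X) = a \<odot>\<^bsub>N\<^esub> f X"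
  using assms by (auto simp: module_hom_def)

lemma module_hom_congI:
  assumes "f \<in> module_hom A L N" "\<And>X. X \<in> carrier L \<Longrightarrow> h X = f X"
  shows "h \<in> module_hom A L N"
  using assms by (auto simp: module_hom_def)

lemma connD:
  assumes "conn D"
  shows "X \<in> carrier L \<Longrightarrow> D X \<in> carrier E"
    and "\<lbrakk>X \<in> carrier L; Y \<in> carrier L\<rbrakk> \<Longrightarrow> D (X \<oplus>\<^bsub>L\<^esub> Y) = D X \<oplus>\<^bsub>E\<^esub> D Y"
    and "\<lbrakk>a \<in> carrier A; X \<in> carrier L\<rbrakk> \<Longrightarrow> D (a \<odot>\<^bsub>L\<^esub> X) = a \<odot>\<^bsub>E\<^esub> D X"
    and "\<lbrakk>X \<in> carrier L; a \<in> carrier A; v \<in> carrier V\<rbrakk>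
      \<Longrightarrow> D X (a \<odot>\<^bsub>V\<^esub> v) = act X a \<odot>\<^bsub>V\<^esub> v \<oplus>\<^bsub>V\<^esub> a \<odot>\<^bsub>V\<^esub> D X v"
  using assms module_homD[of D E] by (auto simp: L_connection_def)

lemma act_closed: "\<lbrakk>X \<in> carrier L; a \<in> carrier A\<rbrakk> \<Longrightarrow> act X a \<in> carrier A"
  using act_linear[of X] by (auto simp: module_hom_def)

lemma br_closed: "\<lbrakk>X \<in> carrier L; Y \<in> carrier L\<rbrakk> \<Longrightarrow> br X Y \<in> carrier L"
  using br_linear_right[of X] by (auto simp: module_hom_def restrict_scalars_def)

text \<open>An \<open>A\<close>-linear endomorphism contributes no derivative term, so adding one keeps the Leibniz
  rule.\<close>

lemma connection_add_form:
  assumes D: "conn D" and \<theta>: "\<theta> \<in> module_hom A L EA"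
  shows "conn (add_form K A V D \<theta>)"
  unfolding L_connection_def
proof (intro conjI ballI)
  note \<theta>' = module_homD[OF \<theta>, unfolded EA_eq_E]
  have \<theta>E: "\<theta> X \<in> carrier E" if "X \<in> carrier L" for X
    using EA_subset_E \<theta>'(1) that by blast
  show "add_form K A V D \<theta> \<in> module_hom A L E"
    by (rule module_homI)
      (auto simp: add_form_def connD[OF D] \<theta>'(2,3) \<theta>E E.a_ac EM.smult_r_distr)
  fix X a v assume *: "X \<in> carrier L" "a \<in> carrier A" "v \<in> carrier V"
  then show "add_form K A V D \<theta> X (a \<odot>\<^bsub>V\<^esub> v)
      = act X a \<odot>\<^bsub>V\<^esub> v \<oplus>\<^bsub>V\<^esub> a \<odot>\<^bsub>V\<^esub> add_form K A V D \<theta> X v"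
    using E_D(1)[OF connD(1)[OF D]]
    by (simp add: add_form_def E_ops connD(4)[OF D] End_modD[OF \<theta>'(1)] act_closed
        V.smult_r_distr V.M.a_assoc)
qed

text \<open>The derivative terms \<open>X(a) v\<close> of the two Leibniz rules cancel, which leaves an \<open>A\<close>-linear
  endomorphism.\<close>

lemma connection_diff:
  assumes D: "conn D" and D': "conn D'"
  shows "(\<lambda>X. D' X \<ominus>\<^bsub>E\<^esub> D X) \<in> module_hom A L EA"
proof (rule module_homI)
  fix X assume X: "X \<in> carrier L"
  note DX = connD(1)[OF D X] and DX' = connD(1)[OF D' X]
  note diff = E.minus_closed[OF DX' DX]
  show "D' X \<ominus>\<^bsub>E\<^esub> D X \<in> carrier EA"
  proof (rule End_modI)
    fix a v assume *: "a \<in> carrier A" "v \<in> carrier V"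
    let ?w = "act X a \<odot>\<^bsub>V\<^esub> v"
    have c: "?w \<in> carrier V" "a \<odot>\<^bsub>V\<^esub> D' X v \<in> carrier V" "a \<odot>\<^bsub>V\<^esub> D X v \<in> carrier V"
      "D' X v \<in> carrier V" "D X v \<in> carrier V"
      using * X by (simp_all add: act_closed E_D(1)[OF DX] E_D(1)[OF DX'])
    have "(D' X \<ominus>\<^bsub>E\<^esub> D X) (a \<odot>\<^bsub>V\<^esub> v)
        = (?w \<oplus>\<^bsub>V\<^esub> a \<odot>\<^bsub>V\<^esub> D' X v) \<ominus>\<^bsub>V\<^esub> (?w \<oplus>\<^bsub>V\<^esub> a \<odot>\<^bsub>V\<^esub> D X v)"
      using * X by (simp add: E_minus_apply DX DX' connD(4)[OF D] connD(4)[OF D'])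
    also have "\<dots> = a \<odot>\<^bsub>V\<^esub> D' X v \<ominus>\<^bsub>V\<^esub> a \<odot>\<^bsub>V\<^esub> D X v"
    proof -
      have "(?w \<oplus>\<^bsub>V\<^esub> a \<odot>\<^bsub>V\<^esub> D' X v) \<ominus>\<^bsub>V\<^esub> (?w \<oplus>\<^bsub>V\<^esub> a \<odot>\<^bsub>V\<^esub> D X v)
          = (?w \<oplus>\<^bsub>V\<^esub> \<ominus>\<^bsub>V\<^esub> ?w) \<oplus>\<^bsub>V\<^esub> (a \<odot>\<^bsub>V\<^esub> D' X v \<ominus>\<^bsub>V\<^esub> a \<odot>\<^bsub>V\<^esub> D X v)"
        using c by (simp add: a_minus_def V.M.minus_add V.M.a_ac)
      then show ?thesis
        using c by (simp add: V.M.r_neg)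
    qed
    also have "\<dots> = a \<odot>\<^bsub>V\<^esub> (D' X v \<ominus>\<^bsub>V\<^esub> D X v)"
      using * c by (simp add: a_minus_def V.smult_r_distr V.smult_r_minus)
    finally show "(D' X \<ominus>\<^bsub>E\<^esub> D X) (a \<odot>\<^bsub>V\<^esub> v) = a \<odot>\<^bsub>V\<^esub> (D' X \<ominus>\<^bsub>E\<^esub> D X) v"
      using * by (simp add: E_minus_apply DX DX')
  qed (use E_D[OF diff] in auto)
qed (auto simp: connD[OF D] connD[OF D'] EA_eq_E a_minus_def EM.smult_r_distr
    EM.smult_r_minus E.minus_add E.a_ac)

context
  fixes g h
  assumes g: "g \<in> carrier EA" and h: "h \<in> carrier EA"
    and gh: "g \<otimes>\<^bsub>E\<^esub> h = \<one>\<^bsub>E\<^esub>" and hg: "h \<otimes>\<^bsub>E\<^esub> g = \<one>\<^bsub>E\<^esub>"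
begin

lemmas gE = EA_subset_E[OF g] and hE = EA_subset_E[OF h]

text \<open>Since \<open>g\<close> and \<open>h\<close> are \<open>A\<close>-linear, they pass through the Leibniz rule, and the derivative term
  becomes \<open>g (X(a) h v) = X(a) v\<close>.\<close>

lemma connection_conj:
  assumes D: "conn D"
  shows "conn (\<lambda>X. g \<otimes>\<^bsub>E\<^esub> D X \<otimes>\<^bsub>E\<^esub> h)"
  unfolding L_connection_def
proof (intro conjI ballI)
  show "(\<lambda>X. g \<otimes>\<^bsub>E\<^esub> D X \<otimes>\<^bsub>E\<^esub> h) \<in> module_hom A L E"
  proof (rule module_homI)
    fix a X assume *: "a \<in> carrier A" "X \<in> carrier L"
    show "g \<otimes>\<^bsub>E\<^esub> D (a \<odot>\<^bsub>L\<^esub> X) \<otimes>\<^bsub>E\<^esub> h = a \<odot>\<^bsub>E\<^esub> (g \<otimes>\<^bsub>E\<^esub> D X \<otimes>\<^bsub>E\<^esub> h)"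
      using * by (auto simp: connD(3)[OF D] E_ops compose_def End_modD[OF g] End_modD[OF h]
          E_D(1)[OF connD(1)[OF D]])
  qed (auto simp: connD[OF D] gE hE E.l_distr E.r_distr)
  fix X a v assume *: "X \<in> carrier L" "a \<in> carrier A" "v \<in> carrier V"
  have "g (h v) = v"
    using fun_cong[OF gh, of v] * by (simp add: E_ops compose_def)
  then show "(g \<otimes>\<^bsub>E\<^esub> D X \<otimes>\<^bsub>E\<^esub> h) (a \<odot>\<^bsub>V\<^esub> v)
      = act X a \<odot>\<^bsub>V\<^esub> v \<oplus>\<^bsub>V\<^esub> a \<odot>\<^bsub>V\<^esub> (g \<otimes>\<^bsub>E\<^esub> D X \<otimes>\<^bsub>E\<^esub> h) v"
    using * E_D(1)[OF connD(1)[OF D]]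
    by (simp add: E_ops compose_def End_modD[OF g] End_modD[OF h] connD(4)[OF D] act_closed)
qed

lemma curvature_conj:
  assumes D: "conn D" and D': "\<And>X. X \<in> carrier L \<Longrightarrow> D' X = g \<otimes>\<^bsub>E\<^esub> D X \<otimes>\<^bsub>E\<^esub> h"
    and X: "X \<in> carrier L" and Y: "Y \<in> carrier L"
  shows "curvature K A br V D' X Y = g \<otimes>\<^bsub>E\<^esub> curvature K A br V D X Y \<otimes>\<^bsub>E\<^esub> h"
  using X Y
  by (simp add: curvature_def D' br_closed connD(1)[OF D] gE hE hg E.conj_mult E.conj_minus)

text \<open>The induced connection on endomorphisms is a commutator, and the factor \<open>g\<close> cancels \<open>h\<close> in its
  second term.\<close>

lemma mult_End_connection:
  assumes D: "conn D" and X: "X \<in> carrier L"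
  shows "g \<otimes>\<^bsub>E\<^esub> End_connection V D X h = g \<otimes>\<^bsub>E\<^esub> D X \<otimes>\<^bsub>E\<^esub> h \<ominus>\<^bsub>E\<^esub> D X"
proof -
  note DX = connD(1)[OF D X]
  have "End_connection V D X h = D X \<otimes>\<^bsub>E\<^esub> h \<ominus>\<^bsub>E\<^esub> h \<otimes>\<^bsub>E\<^esub> D X"
  proof (rule extensionalityI[of _ "carrier V"])
    show "D X \<otimes>\<^bsub>E\<^esub> h \<ominus>\<^bsub>E\<^esub> h \<otimes>\<^bsub>E\<^esub> D X \<in> extensional (carrier V)"
      by (rule E_D(4)) (simp add: DX hE)
    fix v assume v: "v \<in> carrier V"
    then have "(D X \<otimes>\<^bsub>E\<^esub> h \<ominus>\<^bsub>E\<^esub> h \<otimes>\<^bsub>E\<^esub> D X) v = (D X \<otimes>\<^bsub>E\<^esub> h) v \<ominus>\<^bsub>V\<^esub> (h \<otimes>\<^bsub>E\<^esub> D X) v"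
      by (intro E_minus_apply) (simp_all add: DX hE)
    then show "End_connection V D X h v = (D X \<otimes>\<^bsub>E\<^esub> h \<ominus>\<^bsub>E\<^esub> h \<otimes>\<^bsub>E\<^esub> D X) v"
      using v by (simp add: End_connection_def E_ops compose_def)
  qed (simp add: End_connection_def)
  then have "g \<otimes>\<^bsub>E\<^esub> End_connection V D X h
      = g \<otimes>\<^bsub>E\<^esub> D X \<otimes>\<^bsub>E\<^esub> h \<ominus>\<^bsub>E\<^esub> g \<otimes>\<^bsub>E\<^esub> h \<otimes>\<^bsub>E\<^esub> D X"
    by (simp add: a_minus_def E.r_distr E.r_minus E.m_assoc gE hE DX)
  then show ?thesis
    by (simp add: gh DX)
qed

text \<open>With \<open>f = \<eta>(X)\<close> the left-hand side is \<open>(g.\<eta>)(X)\<close>, which thus measures how far the conjugate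
  of \<open>D + \<eta>\<close> is from \<open>D\<close>.\<close>

lemma gauge_shift:
  assumes D: "conn D" and X: "X \<in> carrier L" and f: "f \<in> carrier E"
  shows "(g \<otimes>\<^bsub>E\<^esub> End_connection V D X h) \<oplus>\<^bsub>E\<^esub> (g \<otimes>\<^bsub>E\<^esub> f \<otimes>\<^bsub>E\<^esub> h)
    = g \<otimes>\<^bsub>E\<^esub> (D X \<oplus>\<^bsub>E\<^esub> f) \<otimes>\<^bsub>E\<^esub> h \<ominus>\<^bsub>E\<^esub> D X"
  using connD(1)[OF D X] f
  by (simp add: mult_End_connection[OF D X] gE hE a_minus_def E.l_distr E.r_distr E.a_ac)

end

end

section \<open>Gauge transformations and curvature\<close>

theorem theorem5p4:
  fixes K :: "('k, 'x) ring_scheme"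
    and A :: "('k, 'a, 'y) module_scheme"
    and L :: "('a, 'l, 'z) module_scheme"
    and br :: "'l \<Rightarrow> 'l \<Rightarrow> 'l"
    and act :: "'l \<Rightarrow> 'a \<Rightarrow> 'a"
    and V :: "('a, 'v, 'w) module_scheme"
    and nabla :: "'l \<Rightarrow> 'v \<Rightarrow> 'v"
    and \<eta> :: "'l \<Rightarrow> 'v \<Rightarrow> 'v"
    and g :: "'v \<Rightarrow> 'v"
  assumes "lie_rinehart K A L br act"
    and "module A V"
    and "L_connection K A L act V nabla"
    and "\<eta> \<in> module_hom A L (End_mod A V)"
    and "g \<in> Aut_mod A V"
  shows "gauge_rho A V nabla g \<in> module_hom A L (End_mod A V) \<and>
    gauge_action A V nabla g \<eta> \<in> module_hom A L (End_mod A V) \<and>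
    L_connection K A L act V (add_form K A V nabla \<eta>) \<and>
    L_connection K A L act V (add_form K A V nabla (gauge_action A V nabla g \<eta>)) \<and>
    (\<forall>X \<in> carrier L. \<forall>Y \<in> carrier L.
      curvature K A br V (add_form K A V nabla (gauge_action A V nabla g \<eta>)) X Y
        = Aut_conj A V g (curvature K A br V (add_form K A V nabla \<eta>) X Y))"
proof -
  interpret lie_rinehart_module K A L br act V
    using assms(1,2) by (simp add: lie_rinehart_module_def)
  note D = assms(3)
  let ?h = "inv\<^bsub>EA\<^esub> g"
  let ?D\<eta> = "add_form K A V nabla \<eta>"
  let ?g\<eta> = "gauge_action A V nabla g \<eta>"
  have g: "g \<in> carrier EA" and h: "?h \<in> carrier EA"
    and gh: "g \<otimes>\<^bsub>E\<^esub> ?h = \<one>\<^bsub>E\<^esub>" and hg: "?h \<otimes>\<^bsub>E\<^esub> g = \<one>\<^bsub>E\<^esub>"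
    using assms(5) EA.Units_r_inv[of g] EA.Units_l_inv[of g] by (auto simp: EA_eq_E)
  note inv = g h gh hg
  have \<eta>: "\<eta> X \<in> carrier E" if "X \<in> carrier L" for X
    using EA_subset_E module_homD(1)[OF assms(4)] that by blast
  have D\<eta>: "conn ?D\<eta>"
    by (rule connection_add_form[OF D assms(4)])
  have rho: "gauge_rho A V nabla g \<in> module_hom A L EA"
    by (rule module_hom_congI[OF connection_diff[OF D connection_conj[OF inv D]]])
      (simp add: gauge_rho_def EA_eq_E mult_End_connection[OF inv D])
  have g\<eta>_eq: "?g\<eta> X = g \<otimes>\<^bsub>E\<^esub> ?D\<eta> X \<otimes>\<^bsub>E\<^esub> ?h \<ominus>\<^bsub>E\<^esub> nabla X" if "X \<in> carrier L" for X
    using gauge_shift[OF inv D that \<eta>[OF that]]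
    by (simp add: gauge_action_def gauge_rho_def Aut_conj_def add_form_def EA_eq_E)
  have g\<eta>: "?g\<eta> \<in> module_hom A L EA"
    by (rule module_hom_congI[OF connection_diff[OF D connection_conj[OF inv D\<eta>]]])
      (rule g\<eta>_eq)
  have conj: "add_form K A V nabla ?g\<eta> X = g \<otimes>\<^bsub>E\<^esub> ?D\<eta> X \<otimes>\<^bsub>E\<^esub> ?h" if X: "X \<in> carrier L" for X
  proof -
    let ?c = "g \<otimes>\<^bsub>E\<^esub> ?D\<eta> X \<otimes>\<^bsub>E\<^esub> ?h"
    have c: "?c \<in> carrier E" "nabla X \<in> carrier E"
      using connD(1)[OF D\<eta> X] connD(1)[OF D X] EA_subset_E[OF g] EA_subset_E[OF h] by simp_all
    have "add_form K A V nabla ?g\<eta> X = nabla X \<oplus>\<^bsub>E\<^esub> (?c \<ominus>\<^bsub>E\<^esub> nabla X)"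
      by (simp add: add_form_def[of _ _ _ _ ?g\<eta>] g\<eta>_eq X)
    also have "\<dots> = (?c \<ominus>\<^bsub>E\<^esub> nabla X) \<oplus>\<^bsub>E\<^esub> nabla X"
      using c by (simp add: E.a_comm)
    also have "\<dots> = ?c"
      using c by (simp add: a_minus_def E.a_assoc E.l_neg)
    finally show ?thesis .
  qed
  have "curvature K A br V (add_form K A V nabla ?g\<eta>) X Y
      = Aut_conj A V g (curvature K A br V ?D\<eta> X Y)"
    if "X \<in> carrier L" "Y \<in> carrier L" for X Y
    using curvature_conj[OF inv D\<eta> conj that] by (simp add: Aut_conj_def EA_eq_E)
  then show ?thesis
    using rho g\<eta> D\<eta> connection_add_form[OF D g\<eta>] by blast
qed

end
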